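(* Assume the Kuratowski–Zorn Maximum Principle (Zorn's lemma). Let $\mathbf{S}$ be a dependence space with set $\Delta$ of directly dependent sets, let $A$ be a basis of $\mathbf{S}$, and let $B \subseteq \mathbf{S}$ be an independent subset. Then there is a subset $A' \subseteq A$ such that the set $B \cup (A \setminus A')$ is also a basis of $\mathbf{S}$.
   Context: A dependence space is a set $\mathbf{S}$ together with a set $\Delta$ whose members are finite subsets of $\mathbf{S}$, each containing at least 2 elements, such that the Transitivity Axiom below holds. A set $A \subseteq \mathbf{S}$ is called directly dependent if $A \in \Delta$. Dependence on a set: for $x \in \mathbf{S}$ and $A \subseteq \mathbf{S}$, the element $x$ is dependent on $A$, written $x \sim \Sigma A$, if either $x \in A$, or there exist a positive integer $n$ and distinct elements $x_0, x_1, \dots, x_n$ of $\mathbf{S}$ with $x_0 = x$, $x_1, \dots, x_n \in A$ and $\{x_0, x_1, \dots, x_n\} \in \Delta$. Transitivity Axiom: for all $x \in \mathbf{S}$ and $A, B \subseteq \mathbf{S}$, if $x \sim \Sigma A$ and $a \sim \Sigma B$ for all $a \in A$, then $x \sim \Sigma B$. A set $A \subseteq \mathbf{S}$ is dependent if there exist a positive integer $n$ and distinct elements $x_0, x_1, \dots, x_n \in A$ with $\{x_0, x_1, \dots, x_n\} \in \Delta$; otherwise $A$ is independent. A basis of $\mathbf{S}$ is an independent set $A \subseteq \mathbf{S}$ such that $x \sim \Sigma A$ for every $x \in \mathbf{S}$. *)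

theory Defs
  imports Main
begin

text \<open>
  \<open>\<Delta>\<close> is the family of directly dependent sets. Distinct elements \<open>x\<^sub>0, \<dots>, x\<^sub>n\<close> are given by a
  function \<open>xs :: nat \<Rightarrow> 'a\<close> injective on \<open>{0..n}\<close>. That the \<open>x\<^sub>i\<close> lie in the ambient set \<open>S\<close> need not
  be said in the definitions below, since members of \<open>\<Delta>\<close> are subsets of \<open>S\<close>.
\<close>

definition dependent_on :: "'a set set \<Rightarrow> 'a \<Rightarrow> 'a set \<Rightarrow> bool" where
  "dependent_on \<Delta> x A \<longleftrightarrow>
     x \<in> A \<or>
     (\<exists>n>0. \<exists>xs :: nat \<Rightarrow> 'a. inj_on xs {0..n} \<and> xs 0 = x \<and> xs ` {1..n} \<subseteq> A \<and> xs ` {0..n} \<in> \<Delta>)"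

definition dependent_set :: "'a set set \<Rightarrow> 'a set \<Rightarrow> bool" where
  "dependent_set \<Delta> A \<longleftrightarrow>
     (\<exists>n>0. \<exists>xs :: nat \<Rightarrow> 'a. inj_on xs {0..n} \<and> xs ` {0..n} \<subseteq> A \<and> xs ` {0..n} \<in> \<Delta>)"

abbreviation independent_set :: "'a set set \<Rightarrow> 'a set \<Rightarrow> bool" where
  "independent_set \<Delta> A \<equiv> \<not> dependent_set \<Delta> A"

locale dependence_space =
  fixes S :: "'a set" and \<Delta> :: "'a set set"
  assumes direct_subset: "D \<in> \<Delta> \<Longrightarrow> D \<subseteq> S"
    and direct_finite: "D \<in> \<Delta> \<Longrightarrow> finite D"
    and direct_card: "D \<in> \<Delta> \<Longrightarrow> 2 \<le> card D"
    and transitivity: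
      "\<lbrakk>x \<in> S; A \<subseteq> S; B \<subseteq> S; dependent_on \<Delta> x A; \<And>a. a \<in> A \<Longrightarrow> dependent_on \<Delta> a B\<rbrakk>
        \<Longrightarrow> dependent_on \<Delta> x B"

definition basis_of :: "'a set \<Rightarrow> 'a set set \<Rightarrow> 'a set \<Rightarrow> bool" where
  "basis_of S \<Delta> A \<longleftrightarrow> A \<subseteq> S \<and> independent_set \<Delta> A \<and> (\<forall>x\<in>S. dependent_on \<Delta> x A)"

end

theory Submission
  imports Defs
begin

text \<open>
  A maximal independent set \<open>M\<close> among those with \<open>B \<subseteq> M \<subseteq> B \<union> A\<close> is the required basis, and
  \<open>A' = A - M\<close>. Zorn's lemma provides \<open>M\<close>: directly dependent sets are finite, so a dependence
  inside the union of a chain already occurs inside one member of the chain. By maximality every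
  element of \<open>A\<close> is dependent on \<open>M\<close>, since adjoining it to \<open>M\<close> creates a directly dependent set,
  which must contain the new element. Every element of \<open>S\<close> is dependent on \<open>A\<close>, so the
  Transitivity Axiom makes it dependent on \<open>M\<close>.
\<close>

context dependence_space
begin

text \<open>
  A member of \<open>\<Delta>\<close> is finite with at least two elements, so it can be enumerated injectively as
  \<open>x\<^sub>0, \<dots>, x\<^sub>n\<close> with \<open>n > 0\<close>, starting from any prescribed element. With this, both notions of
  dependence can be stated by membership in \<open>\<Delta>\<close> alone.
\<close>

lemma direct_enumeration:
  assumes "D \<in> \<Delta>" "x \<in> D"
  obtains n and xs :: "nat \<Rightarrow> 'a"
  where "n > 0" "inj_on xs {0..n}" "xs 0 = x" "xs ` {1..n} = D - {x}" "xs ` {0..n} = D"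
proof -
  define n where "n = card (D - {x})"
  have fin: "finite (D - {x})" using direct_finite[OF assms(1)] by simp
  have "n = card D - 1" using assms(2) by (simp add: n_def)
  then have "n > 0" using direct_card[OF assms(1)] by linarith
  have "card {1..n} = card (D - {x})" by (simp add: n_def)
  then obtain f where f: "bij_betw f {1..n} (D - {x})"
    using finite_same_card_bij[of "{1..n}" "D - {x}"] fin by auto
  define xs where "xs = f(0 := x)"
  have split: "{0..n} = insert 0 {1..n}" by auto
  have img: "xs ` {1..n} = D - {x}"
    unfolding bij_betw_imp_surj_on[OF f, symmetric] by (rule image_cong) (simp_all add: xs_def)
  have inj1: "inj_on xs {1..n}"
    using bij_betw_imp_inj_on[OF f] by (subst inj_on_cong[of _ _ f]) (simp_all add: xs_def)
  have x0: "xs 0 = x" by (simp add: xs_def)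
  have "inj_on xs {0..n}"
    using inj1 img x0 by (simp add: split)
  moreover have "xs ` {0..n} = D"
    using img x0 assms(2) by (simp only: split image_insert insert_Diff)
  ultimately show thesis using that \<open>n > 0\<close> x0 img by blast
qed

lemma dependent_on_iff:
  "dependent_on \<Delta> x A \<longleftrightarrow> x \<in> A \<or> (\<exists>D\<in>\<Delta>. x \<in> D \<and> D - {x} \<subseteq> A)"
proof
  assume "dependent_on \<Delta> x A"
  then consider "x \<in> A"
    | n and xs :: "nat \<Rightarrow> 'a" where "xs 0 = x" "xs ` {1..n} \<subseteq> A" "xs ` {0..n} \<in> \<Delta>"
    unfolding dependent_on_def by blast
  then show "x \<in> A \<or> (\<exists>D\<in>\<Delta>. x \<in> D \<and> D - {x} \<subseteq> A)"
  proof cases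
    case 2
    have "{0..n} = insert 0 {1..n}" by auto
    then have "xs ` {0..n} = insert x (xs ` {1..n})" using 2(1) by auto
    then show ?thesis using 2(2,3) by blast
  qed simp
next
  assume "x \<in> A \<or> (\<exists>D\<in>\<Delta>. x \<in> D \<and> D - {x} \<subseteq> A)"
  then show "dependent_on \<Delta> x A"
  proof
    assume "\<exists>D\<in>\<Delta>. x \<in> D \<and> D - {x} \<subseteq> A"
    then obtain D where D: "D \<in> \<Delta>" "x \<in> D" "D - {x} \<subseteq> A" by blast
    obtain n and xs :: "nat \<Rightarrow> 'a" where
      "n > 0" "inj_on xs {0..n}" "xs 0 = x" "xs ` {1..n} = D - {x}" "xs ` {0..n} = D"
      by (rule direct_enumeration[OF D(1,2)])
    then have "n > 0 \<and> inj_on xs {0..n} \<and> xs 0 = x \<and> xs ` {1..n} \<subseteq> A \<and> xs ` {0..n} \<in> \<Delta>"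
      using D(1,3) by simp
    then show ?thesis unfolding dependent_on_def by blast
  qed (simp add: dependent_on_def)
qed

lemma dependent_set_iff: "dependent_set \<Delta> A \<longleftrightarrow> (\<exists>D\<in>\<Delta>. D \<subseteq> A)"
proof
  assume "\<exists>D\<in>\<Delta>. D \<subseteq> A"
  then obtain D where D: "D \<in> \<Delta>" "D \<subseteq> A" by blast
  then obtain x where "x \<in> D" using direct_card[OF D(1)] by fastforce
  obtain n and xs :: "nat \<Rightarrow> 'a" where
    "n > 0" "inj_on xs {0..n}" "xs ` {0..n} = D"
    by (rule direct_enumeration[OF D(1) \<open>x \<in> D\<close>])
  then have "n > 0 \<and> inj_on xs {0..n} \<and> xs ` {0..n} \<subseteq> A \<and> xs ` {0..n} \<in> \<Delta>"
    using D by simp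
  then show "dependent_set \<Delta> A" unfolding dependent_set_def by blast
qed (auto simp: dependent_set_def)

lemma dependent_on_if_insert_dependent:
  assumes "independent_set \<Delta> M" "dependent_set \<Delta> (insert a M)"
  shows "dependent_on \<Delta> a M"
  using assms unfolding dependent_set_iff dependent_on_iff by blast

lemma independent_Union_chain:
  assumes "\<C> \<noteq> {}" "subset.chain \<A> \<C>" "\<And>M. M \<in> \<C> \<Longrightarrow> independent_set \<Delta> M"
  shows "independent_set \<Delta> (\<Union>\<C>)"
proof
  assume "dependent_set \<Delta> (\<Union>\<C>)"
  then obtain D where D: "D \<in> \<Delta>" "D \<subseteq> \<Union>\<C>" unfolding dependent_set_iff by blast
  from direct_finite[OF D(1)] D(2) assms(1,2)
  obtain M where "M \<in> \<C>" "D \<subseteq> M" by (rule finite_subset_Union_chain)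
  then show False using assms(3) D(1) unfolding dependent_set_iff by blast
qed

lemma maximal_independent_between:
  assumes "independent_set \<Delta> B" "B \<subseteq> C"
  obtains M where "B \<subseteq> M" "M \<subseteq> C" "independent_set \<Delta> M"
    "\<And>a. a \<in> C - M \<Longrightarrow> dependent_set \<Delta> (insert a M)"
proof -
  let ?F = "{M. B \<subseteq> M \<and> M \<subseteq> C \<and> independent_set \<Delta> M}"
  have "?F \<noteq> {}" using assms by blast
  moreover have "\<Union>\<C> \<in> ?F" if ne: "\<C> \<noteq> {}" and ch: "subset.chain ?F \<C>" for \<C>
  proof -
    have "\<C> \<subseteq> ?F" using ch by (simp add: subset.chain_def)
    moreover from this have "independent_set \<Delta> (\<Union>\<C>)"
      using independent_Union_chain[OF ne ch] by blast
    ultimately show ?thesis using ne by blast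
  qed
  ultimately obtain M where M: "M \<in> ?F" and max: "\<forall>X\<in>?F. M \<subseteq> X \<longrightarrow> X = M"
    using subset_Zorn_nonempty[of ?F] by blast
  have "dependent_set \<Delta> (insert a M)" if "a \<in> C - M" for a
  proof (rule ccontr)
    assume "independent_set \<Delta> (insert a M)"
    then have "insert a M \<in> ?F" using M that by blast
    then have "insert a M = M" using max by (meson subset_insertI)
    then show False using that by blast
  qed
  then show thesis using that M by blast
qed

end

theorem theorem6p1:
  fixes S :: "'a set" and \<Delta> :: "'a set set" and A B :: "'a set"
  assumes "dependence_space S \<Delta>"
    and "basis_of S \<Delta> A"
    and "B \<subseteq> S" and "independent_set \<Delta> B"
  shows "\<exists>A'. A' \<subseteq> A \<and> basis_of S \<Delta> (B \<union> (A - A'))"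
proof -
  interpret dependence_space S \<Delta> by fact
  have A: "A \<subseteq> S" "\<And>x. x \<in> S \<Longrightarrow> dependent_on \<Delta> x A"
    using assms(2) by (auto simp: basis_of_def)
  obtain M where M: "B \<subseteq> M" "M \<subseteq> B \<union> A" "independent_set \<Delta> M"
    and max: "\<And>a. a \<in> (B \<union> A) - M \<Longrightarrow> dependent_set \<Delta> (insert a M)"
    using maximal_independent_between[OF assms(4), of "B \<union> A"] by blast
  have MS: "M \<subseteq> S" using M(2) A(1) assms(3) by blast
  have A_on_M: "dependent_on \<Delta> a M" if "a \<in> A" for a
  proof (cases "a \<in> M")
    case True
    then show ?thesis by (simp add: dependent_on_iff)
  next
    case False
    then show ?thesis using that max dependent_on_if_insert_dependent[OF M(3)] by blast
  qed
  have "dependent_on \<Delta> x M" if "x \<in> S" for x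
    using transitivity[OF that A(1) MS A(2)[OF that]] A_on_M by blast
  then have "basis_of S \<Delta> M" using MS M(3) by (simp add: basis_of_def)
  moreover have "B \<union> (A - (A - M)) = M" using M(1,2) by blast
  ultimately show ?thesis by (metis Diff_subset)
qed

end
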